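(* Let $\{W(k)\}$ be any balanced adapted random stochastic matrix process of size $m\times m$ such that, for some $\gamma>0$, for all $i\in[m]$ and $k\ge 0$ we have $W_{ii}(k)\ge\gamma>0$ almost surely. Then the dynamics $x(k+1)=W(k+1)x(k)$, $k\ge 0$, started from the random vector $x(0):\Omega\to\mathbb{R}^m$, converges almost surely. Moreover, for $i,j\in[m]$, $\lim_{k\to\infty}x_i(k,\omega)=\lim_{k\to\infty}x_j(k,\omega)$ if and only if $i,j$ belong to the same connected component of the infinite flow graph $G^\infty(\omega)$.
   Context: Let $(\Omega,\mathcal{M},\mathsf{Pr})$ be a probability space and $[m]=\{1,\dots,m\}$. A stochastic matrix is an entrywise non-negative $m\times m$ real matrix each of whose rows sums to one. A random stochastic matrix process is a sequence $\{W(k)\}$ of measurable maps from $\Omega$ to the set of $m\times m$ stochastic matrices. The initial condition $x(0):\Omega\to\mathbb{R}^m$ is a random vector, i.e. each of its entries is measurable with respect to $\mathcal{M}$, and $x(k,\omega)$ denotes the value at $\omega\in\Omega$ of the resulting random trajectory. Let $\mathcal{F}_k$ be the smallest $\sigma$-algebra with respect to which $x(0),W(1),\dots,W(k)$ are measurable; adapted means that $W(k)$ is measurable with respect to $\mathcal{F}_k$ and $x(0)$ is measurable with respect to $\mathcal{F}_0$. For a matrix $W$ and non-trivial subsets $S,T\subset[m]$ (i.e. different from $\emptyset$ and $[m]$), write $W_{ST}=\sum_{i\in S}\sum_{j\in T}W_{ij}$, and let $\bar S=[m]\setminus S$. The process $\{W(k)\}$ is balanced if there is some $\alpha>0$ such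 that for every non-trivial $S\subset[m]$ and every $k\ge 0$, $$\mathsf{E}[W_{\bar S S}(k+1)\mid W(k),\dots,W(1),x(0)]\ \ge\ \alpha\,\mathsf{E}[W_{S\bar S}(k+1)\mid W(k),\dots,W(1),x(0)].$$ The infinite flow graph of $\{W(k)\}$ is the random undirected graph $G^\infty=([m],\mathcal{E}^\infty)$ with edge set $\mathcal{E}^\infty(\omega)=\{\{i,j\}\mid \sum_{k=0}^{\infty}(W_{ij}(k,\omega)+W_{ji}(k,\omega))=\infty\}$.
   Formalization: The "only if" half fails for one fixed x(0) (W(k)=I, x(0)=0); it is proved instead in this form: if, for every start time s and every vector y(s), the solution of the dynamics has equal limits at i and j, then i, j are in the same component. *)

theory Defs
  imports "HOL-Probability.Probability"
begin

definition stochastic_matrix :: "real ^ 'm ^ 'm \<Rightarrow> bool" where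
  "stochastic_matrix A \<longleftrightarrow> (\<forall>i j. 0 \<le> A $ i $ j) \<and> (\<forall>i. (\<Sum>j\<in>UNIV. A $ i $ j) = 1)"

definition random_stochastic_matrix_process ::
    "'a measure \<Rightarrow> (nat \<Rightarrow> 'a \<Rightarrow> real ^ 'm ^ 'm) \<Rightarrow> bool" where
  "random_stochastic_matrix_process M W \<longleftrightarrow>
     (\<forall>k. W k \<in> borel_measurable M \<and> (\<forall>\<omega>\<in>space M. stochastic_matrix (W k \<omega>)))"

text \<open>The smallest sigma-algebra on the sample space making the initial vector and the matrices with
  index from 1 to \<open>k\<close> measurable; the matrix with index 0 is not used, as the dynamics never
  applies it.\<close>

definition history ::
    "'a measure \<Rightarrow> ('a \<Rightarrow> real ^ 'm) \<Rightarrow> (nat \<Rightarrow> 'a \<Rightarrow> real ^ 'm ^ 'm) \<Rightarrow> nat \<Rightarrow> 'a measure" where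
  "history M x0 W k = sigma (space M)
     ({x0 -` A \<inter> space M | A. A \<in> sets borel} \<union>
      {W j -` A \<inter> space M | j A. 1 \<le> j \<and> j \<le> k \<and> A \<in> sets borel})"

definition adapted ::
    "'a measure \<Rightarrow> ('a \<Rightarrow> real ^ 'm) \<Rightarrow> (nat \<Rightarrow> 'a \<Rightarrow> real ^ 'm ^ 'm) \<Rightarrow> bool" where
  "adapted M x0 W \<longleftrightarrow>
     x0 \<in> borel_measurable (history M x0 W 0) \<and>
     (\<forall>k. W k \<in> borel_measurable (history M x0 W k))"

definition cut_sum :: "real ^ 'm ^ 'm \<Rightarrow> 'm set \<Rightarrow> 'm set \<Rightarrow> real" where
  "cut_sum A S T = (\<Sum>i\<in>S. \<Sum>j\<in>T. A $ i $ j)"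

definition balanced ::
    "'a measure \<Rightarrow> ('a \<Rightarrow> real ^ 'm) \<Rightarrow> (nat \<Rightarrow> 'a \<Rightarrow> real ^ 'm ^ 'm) \<Rightarrow> bool" where
  "balanced M x0 W \<longleftrightarrow>
     (\<exists>\<alpha>>0. \<forall>S. S \<noteq> {} \<longrightarrow> S \<noteq> UNIV \<longrightarrow> (\<forall>k. AE \<omega> in M.
        real_cond_exp M (history M x0 W k) (\<lambda>\<omega>. cut_sum (W (Suc k) \<omega>) (- S) S) \<omega>
        \<ge> \<alpha> * real_cond_exp M (history M x0 W k) (\<lambda>\<omega>. cut_sum (W (Suc k) \<omega>) S (- S)) \<omega>))"

definition infinite_flow_edges ::
    "(nat \<Rightarrow> 'a \<Rightarrow> real ^ 'm ^ 'm) \<Rightarrow> 'a \<Rightarrow> 'm set set" where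
  "infinite_flow_edges W \<omega> =
     {{i, j} | i j. (\<Sum>k. ennreal (W k \<omega> $ i $ j + W k \<omega> $ j $ i)) = \<infinity>}"

text \<open>Connected components of the undirected graph with vertex set \<open>UNIV\<close> and edge set \<open>E\<close>.\<close>

definition connected_components :: "'v set set \<Rightarrow> 'v set set" where
  "connected_components E = UNIV // {(u, v). {u, v} \<in> E}\<^sup>*"

definition same_component :: "'v set set \<Rightarrow> 'v \<Rightarrow> 'v \<Rightarrow> bool" where
  "same_component E i j \<longleftrightarrow> (\<exists>C \<in> connected_components E. i \<in> C \<and> j \<in> C)"

text \<open>A solution of the averaging dynamics started at time \<open>s\<close> from the arbitrary vector \<open>y s\<close>;
  the values of \<open>y\<close> before time \<open>s\<close> are irrelevant. Start times other than 0 are needed because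
  finitely many matrices can merge the limits of vertices in different components: if the first
  matrix has all entries equal and all later ones are the identity, then every solution
  started at time 0 reaches consensus although the infinite flow graph has no edge between
  distinct vertices.\<close>

definition averaging_trajectory ::
    "(nat \<Rightarrow> real ^ 'm ^ 'm) \<Rightarrow> nat \<Rightarrow> (nat \<Rightarrow> real ^ 'm) \<Rightarrow> bool" where
  "averaging_trajectory A s y \<longleftrightarrow> (\<forall>k\<ge>s. y (Suc k) = A (Suc k) *v y k)"

end

theory Submission
  imports Defs
begin

text \<open>The potential \<open>V x = (\<Sum>R\<noteq>{}. K ^ card R * (MIN i\<in>R. x $ i))\<close> is superadditive, and additive on the
  decomposition of \<open>x\<close> into a constant and nonnegative multiples of indicators of its superlevel
  sets. Hence \<open>V (A x) - V x\<close> is bounded below by a sum over the sublevel sets \<open>S\<close> of \<open>x\<close> of terms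
  proportional to \<open>\<gamma> * K * A\<^bsub>S,-S\<^esub> - A\<^bsub>-S,S\<^esub>\<close>. With \<open>\<gamma> * K = 1 + 2 / \<alpha>\<close>, balancedness makes the
  conditional expectation of each term dominate the total flow across \<open>S\<close>. As \<open>V\<close> is bounded along
  trajectories, \<open>\<Sum>k. \<Sum>i j. W\<^sub>i\<^sub>j(k+1) * \<bar>x\<^sub>i(k) - x\<^sub>j(k)\<bar>\<close> is almost surely finite. This makes the
  increments summable and forces equal limits along edges of infinite flow. By linearity it is
  enough to treat the countably many trajectories that start from a unit vector at some time.
  Conversely, if the total flow between a component and its complement is finite, a trajectory
  started late enough from the indicator of the component stays close to it.\<close>

section \<open>A potential driven by cut flows\<close>

definition cuts :: "'m set set" where
  "cuts = - {{}, UNIV}"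

text \<open>The gap of \<open>S\<close> is the length of the interval of thresholds \<open>t\<close> with \<open>{i. x $ i \<le> t} = S\<close>, so
  it vanishes unless \<open>S\<close> is a sublevel set. Sums over cuts weighted by gaps replace an explicit
  sorting of the entries of \<open>x\<close>, and the weights depend measurably on \<open>x\<close>.\<close>

definition gap :: "'m::finite set \<Rightarrow> real ^ 'm \<Rightarrow> real" where
  "gap S x = max 0 (Min (($) x ` (- S)) - Max (($) x ` S))"

section \<open>Decomposing a vector along its sublevel sets\<close>

lemma gap_nonneg: "0 \<le> gap S x"
  by (simp add: gap_def)

lemma gap_separates:
  assumes "gap S x \<noteq> 0" "a \<in> S" "b \<notin> S"
  shows "x $ a < x $ b"
proof -
  have "Max (($) x ` S) < Min (($) x ` (- S))"
    using assms(1) by (simp add: gap_def max_def split: if_splits)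
  moreover have "x $ a \<le> Max (($) x ` S)" "Min (($) x ` (- S)) \<le> x $ b"
    using assms by auto
  ultimately show ?thesis by linarith
qed

text \<open>Consecutive values of \<open>x\<close> bound the threshold interval of one sublevel set;
  this evaluates the only gap by which their expansions in \<open>gap_decomposition\<close>
  differ.\<close>

lemma gap_predecessor:
  assumes lt: "x $ i' < x $ i" and pred: "\<And>j. x $ j < x $ i \<Longrightarrow> x $ j \<le> x $ i'"
  shows "gap {j. x $ j < x $ i} x = x $ i - x $ i'"
proof -
  let ?S = "{j. x $ j < x $ i}"
  have "Max (($) x ` ?S) = x $ i'"
    by (rule Max_eqI) (use assms in auto)
  moreover have "Min (($) x ` (- ?S)) = x $ i"
    by (rule Min_eqI) (use assms in auto)
  ultimately show ?thesis using lt by (simp add: gap_def)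
qed

text \<open>A discrete layer-cake formula. Climbing through the distinct values of \<open>x\<close>
  from the smallest one adds one gap at a time; the induction counts the entries strictly below
  \<open>x $ i\<close>.\<close>

lemma gap_decomposition:
  fixes x :: "real ^ 'm::finite"
  shows "x $ i = Min (range (($) x)) + (\<Sum>S\<in>cuts. if i \<in> S then 0 else gap S x)"
proof (induction "card {j. x $ j < x $ i}" arbitrary: i rule: less_induct)
  case less
  show ?case
  proof (cases "{j. x $ j < x $ i} = {}")
    case True
    then have le: "x $ i \<le> x $ j" for j by (auto simp: not_less)
    have "Min (range (($) x)) = x $ i"
      by (rule Min_eqI) (use le in auto)
    moreover have "(if i \<in> S then 0 else gap S x) = 0" if "S \<in> cuts" for S
    proof (rule ccontr)
      assume "\<not> ?thesis"
      then have "i \<notin> S" "gap S x \<noteq> 0" by (auto split: if_splits)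
      moreover obtain a where "a \<in> S" using \<open>S \<in> cuts\<close> by (auto simp: cuts_def)
      ultimately show False using gap_separates[of S x a i] le[of a] by auto
    qed
    ultimately show ?thesis by simp
  next
    case False
    let ?L = "{j. x $ j < x $ i}"
    \<comment> \<open>The index \<open>i'\<close> carries the largest value below
      \<open>x $ i\<close>; fewer entries lie below it, so induction applies.\<close>
    have "Max (($) x ` ?L) \<in> ($) x ` ?L" using False by (intro Max_in) auto
    then obtain i' where i': "x $ i' < x $ i" "Max (($) x ` ?L) = x $ i'" by auto
    have pred: "x $ j \<le> x $ i'" if "x $ j < x $ i" for j
      unfolding i'(2)[symmetric] using that by (intro Max_ge) auto
    have "card {j. x $ j < x $ i'} < card ?L"
      by (rule psubset_card_mono) (use i'(1) in auto)
    note IH = less[OF this]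
    have L: "?L \<in> cuts" using False by (auto simp: cuts_def)
    have "(if i \<in> S then 0 else gap S x) =
        (if i' \<in> S then 0 else gap S x) + (if S = ?L then x $ i - x $ i' else 0)"
      if "S \<in> cuts" for S
    proof (cases "S = ?L")
      case True
      then show ?thesis using gap_predecessor[OF i'(1) pred] i'(1) by auto
    next
      case neq: False
      show ?thesis
      proof (cases "gap S x = 0")
        case True
        then show ?thesis using neq by simp
      next
        case nz: False
        note sep = gap_separates[OF nz]
        \<comment> \<open>A set with nonzero gap that separates \<open>i'\<close> from
          \<open>i\<close> must cut between two consecutive values, so it would be
          \<open>?L\<close>, which is excluded here.\<close>
        have "i \<in> S \<longleftrightarrow> i' \<in> S"
        proof
          assume "i \<in> S"
          then show "i' \<in> S" using sep[of i i'] i'(1) by force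
        next
          assume "i' \<in> S"
          show "i \<in> S"
          proof (rule ccontr)
            assume "i \<notin> S"
            have "S = ?L"
            proof (intro set_eqI iffI)
              fix j assume "j \<in> S"
              then show "j \<in> ?L" using sep[of j i] \<open>i \<notin> S\<close> by auto
            next
              fix j assume "j \<in> ?L"
              then have "x $ j \<le> x $ i'" using pred by auto
              then show "j \<in> S" using sep[of i' j] \<open>i' \<in> S\<close> by force
            qed
            then show False using neq by simp
          qed
        qed
        then show ?thesis using neq by simp
      qed
    qed
    then have "(\<Sum>S\<in>cuts. if i \<in> S then 0 else gap S x) =
        (\<Sum>S\<in>cuts. if i' \<in> S then 0 else gap S x) + (x $ i - x $ i')"
      using L by (simp add: sum.distrib)
    then show ?thesis using IH by linarith
  qed
qed

text \<open>The indicator of the complement, because gaps are indexed by sublevel sets while the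
  layers of \<open>x\<close> live on superlevel sets.\<close>

definition cut_vec :: "'m::finite set \<Rightarrow> real ^ 'm" where
  "cut_vec S = (\<chi> i. if i \<in> S then 0 else 1)"

lemma Min_cut_vec:
  assumes "R \<noteq> {}"
  shows "Min (($) (cut_vec S) ` R) = (if R \<inter> S = {} then 1 else 0)"
  by (rule Min_eqI) (use assms in \<open>auto simp: cut_vec_def image_iff\<close>)

text \<open>The minimum is additive here because the layers are comonotone: an index in
  \<open>R\<close> that minimizes \<open>x\<close> also minimizes every \<open>cut_vec S\<close>
  with nonzero gap.\<close>

lemma Min_gap_decomposition:
  fixes x :: "real ^ 'm::finite"
  assumes "R \<noteq> {}"
  shows "Min (($) x ` R) =
    Min (range (($) x)) + (\<Sum>S\<in>cuts. gap S x * Min (($) (cut_vec S) ` R))"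
proof -
  have "Min (($) x ` R) \<in> ($) x ` R" using assms by (intro Min_in) auto
  then obtain i where i: "i \<in> R" "Min (($) x ` R) = x $ i" by auto
  have "gap S x * Min (($) (cut_vec S) ` R) = (if i \<in> S then 0 else gap S x)" for S
  proof (cases "gap S x = 0")
    case False
    have "R \<inter> S = {} \<longleftrightarrow> i \<notin> S"
    proof
      assume "i \<notin> S"
      show "R \<inter> S = {}"
      proof (rule ccontr)
        assume "R \<inter> S \<noteq> {}"
        then obtain j where "j \<in> R" "j \<in> S" by auto
        then have "x $ j < x $ i" "Min (($) x ` R) \<le> x $ j"
          using gap_separates[OF False, of j i] \<open>i \<notin> S\<close> by auto
        then show False using i(2) by linarith
      qed
    qed (use i in auto)
    then show ?thesis by (simp add: Min_cut_vec assms)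
  qed simp
  then show ?thesis using i(2) gap_decomposition[of x i] by simp
qed

section \<open>The potential and its drift\<close>

definition potential :: "real \<Rightarrow> real ^ 'm::finite \<Rightarrow> real" where
  "potential K x = (\<Sum>R\<in>- {{}}. K ^ card R * Min (($) x ` R))"

text \<open>In closed form \<open>(1 + K) ^ card T\<close>; the sum over subsets matches the shape
  of the potential.\<close>

definition subset_weight :: "real \<Rightarrow> 'm::finite set \<Rightarrow> real" where
  "subset_weight K T = (\<Sum>R\<in>Pow T. K ^ card R)"

lemma subset_weight_split:
  "subset_weight K (T :: 'm::finite set) = 1 + (\<Sum>R\<in>Pow T - {{}}. K ^ card R)"
  unfolding subset_weight_def by (subst sum.remove[of _ "{}"]) auto

lemma subset_weight_ge_1:
  assumes "0 \<le> K"
  shows "1 \<le> subset_weight K (T :: 'm::finite set)"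
  unfolding subset_weight_split by (simp add: assms sum_nonneg)

lemma potential_bounds:
  fixes x :: "real ^ 'm::finite"
  assumes "0 \<le> K" "\<And>i. 0 \<le> x $ i \<and> x $ i \<le> 1"
  shows "0 \<le> potential K x" "potential K x \<le> subset_weight K (UNIV :: 'm set)"
proof -
  have *: "0 \<le> Min (($) x ` R) \<and> Min (($) x ` R) \<le> 1" if "R \<noteq> {}" for R
  proof -
    have "Min (($) x ` R) \<in> ($) x ` R" using that by (intro Min_in) auto
    then show ?thesis using assms(2) by auto
  qed
  show "0 \<le> potential K x"
    unfolding potential_def by (intro sum_nonneg mult_nonneg_nonneg) (use * assms(1) in auto)
  have "potential K x \<le> (\<Sum>R\<in>(- {{}} :: 'm set set). K ^ card R * 1)"
    unfolding potential_def
    by (intro sum_mono mult_left_mono) (use * assms(1) in auto)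
  also have "\<dots> \<le> subset_weight K (UNIV :: 'm set)"
    unfolding subset_weight_split by (simp add: Compl_eq_Diff_UNIV)
  finally show "potential K x \<le> subset_weight K (UNIV :: 'm set)" .
qed

text \<open>For an indicator only the nonempty sets inside \<open>- S\<close> have minimum 1; the
  subtracted 1 is the term of the empty set.\<close>

lemma potential_cut_vec:
  "potential K (cut_vec S) = subset_weight K (- S) - 1"
proof -
  have "potential K (cut_vec S) = (\<Sum>R\<in>- {{}}. if R \<in> Pow (- S) - {{}} then K ^ card R else 0)"
    unfolding potential_def by (intro sum.cong) (auto simp: Min_cut_vec)
  also have "\<dots> = (\<Sum>R\<in>Pow (- S) - {{}}. K ^ card R)"
    by (subst sum.inter_restrict[symmetric]) (auto intro!: sum.cong)
  finally show ?thesis by (simp add: subset_weight_split)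
qed

lemma stochastic_row_le_1:
  assumes "stochastic_matrix (A :: real ^ 'm::finite ^ 'm)"
  shows "(\<Sum>j\<in>T. A $ i $ j) \<le> 1"
proof -
  have "(\<Sum>j\<in>T. A $ i $ j) \<le> (\<Sum>j\<in>UNIV. A $ i $ j)"
    by (rule sum_mono2) (use assms in \<open>auto simp: stochastic_matrix_def\<close>)
  then show ?thesis using assms by (simp add: stochastic_matrix_def)
qed

lemma mult_cut_vec:
  "(A *v cut_vec S) $ i = (\<Sum>j\<in>- S. A $ i $ j)"
proof -
  have "(A *v cut_vec S) $ i = (\<Sum>j\<in>UNIV. if j \<in> - S then A $ i $ j else 0)"
    unfolding matrix_vector_mult_def cut_vec_def by (auto intro!: sum.cong)
  then show ?thesis by (subst (asm) sum.inter_restrict[symmetric]) auto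
qed

text \<open>Weights in the block \<open>- S \<times> S\<close> of \<open>A\<close> lower the minima over sets \<open>R \<subseteq> - S\<close>. Weights in row
  \<open>i \<in> S\<close> of the block \<open>S \<times> - S\<close> raise the minimum over each set \<open>insert i R\<close>, because the diagonal
  bound keeps the entries outside \<open>S\<close> above \<open>\<gamma>\<close>; these sets carry \<open>K\<close> times the weight.\<close>

lemma potential_cut_drift:
  fixes A :: "real ^ 'm::finite ^ 'm"
  assumes A: "stochastic_matrix A" and diag: "\<And>i. \<gamma> \<le> A $ i $ i"
    and g: "0 \<le> \<gamma>" "\<gamma> \<le> 1" and K: "0 \<le> K"
  shows "subset_weight K (- S) * (\<gamma> * K * cut_sum A S (- S) - cut_sum A (- S) S)
    \<le> potential K (A *v cut_vec S) - potential K (cut_vec S)"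
proof -
  define u where "u = ($) (A *v cut_vec S)"
  define b where "b = cut_sum A (- S) S"
  define P where "P = subset_weight K (- S)"
  have nn: "0 \<le> A $ i $ j" for i j using A by (simp add: stochastic_matrix_def)
  have u: "u i = (\<Sum>j\<in>- S. A $ i $ j)" for i by (simp add: u_def mult_cut_vec)
  have u_compl: "u i = 1 - (\<Sum>j\<in>S. A $ i $ j)" for i
  proof -
    have "(\<Sum>j\<in>UNIV. A $ i $ j) = (\<Sum>j\<in>S. A $ i $ j) + (\<Sum>j\<in>- S. A $ i $ j)"
      by (subst sum.union_disjoint[symmetric]) auto
    then show ?thesis using A by (simp add: stochastic_matrix_def u)
  qed
  have u01: "0 \<le> u i" "u i \<le> 1" for i
    using stochastic_row_le_1[OF A] by (auto simp: u nn sum_nonneg)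
  have b0: "0 \<le> b" unfolding b_def cut_sum_def by (intro sum_nonneg nn)
  have u_out: "1 - b \<le> u i" if "i \<notin> S" for i
  proof -
    have "(\<Sum>j\<in>S. A $ i $ j) \<le> b"
      unfolding b_def cut_sum_def
      by (rule member_le_sum[of i "- S" "\<lambda>i. \<Sum>j\<in>S. A $ i $ j"]) (use that nn in \<open>auto intro: sum_nonneg\<close>)
    then show ?thesis by (simp add: u_compl)
  qed
  have u_gamma: "\<gamma> \<le> u i" if "i \<notin> S" for i
  proof -
    have "A $ i $ i \<le> u i"
      unfolding u by (rule member_le_sum) (use that nn in auto)
    then show ?thesis using diag[of i] by linarith
  qed
  \<comment> \<open>\<open>B1\<close> collects the nonempty sets that avoid \<open>S\<close>,
    \<open>B2\<close> those that meet \<open>S\<close> in exactly one element. All other sets have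
    nonnegative terms.\<close>
  define B1 where "B1 = Pow (- S) - {{}}"
  define B2 where "B2 = (\<lambda>(i, R). insert i R) ` (S \<times> Pow (- S))"
  let ?f = "\<lambda>R. K ^ card R * Min (u ` R)"
  have Min_ge: "c \<le> Min (u ` R)" if "R \<noteq> {}" "\<And>i. i \<in> R \<Longrightarrow> c \<le> u i" for c R
    using that by (subst Min_ge_iff) auto
  have inj: "inj_on (\<lambda>(i, R). insert i R) (S \<times> Pow (- S))"
  proof (rule inj_onI, clarify)
    fix i R j T assume "i \<in> S" "R \<subseteq> - S" "j \<in> S" "T \<subseteq> - S" and eq: "insert i R = insert j T"
    then have "insert i R \<inter> S = {i}" "insert j T \<inter> S = {j}"
      "insert i R - S = R" "insert j T - S = T" by auto
    then show "i = j \<and> R = T" using eq by auto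
  qed
  have "(P - 1) * (1 - b) = (\<Sum>R\<in>B1. K ^ card R * (1 - b))"
    by (simp add: P_def B1_def subset_weight_split sum_distrib_right)
  also have "\<dots> \<le> sum ?f B1"
    by (intro sum_mono mult_left_mono Min_ge) (use K u_out in \<open>auto simp: B1_def\<close>)
  finally have 1: "(P - 1) * (1 - b) \<le> sum ?f B1" .
  have "\<gamma> * K * cut_sum A S (- S) * P = (\<Sum>(i, R)\<in>S \<times> Pow (- S). K ^ Suc (card R) * (\<gamma> * u i))"
  proof -
    have "cut_sum A S (- S) = (\<Sum>i\<in>S. u i)" by (simp add: cut_sum_def u)
    then have "\<gamma> * K * cut_sum A S (- S) * P = (\<Sum>i\<in>S. \<gamma> * K * u i) * P"
      by (simp add: sum_distrib_left)
    also have "\<dots> = (\<Sum>(i, R)\<in>S \<times> Pow (- S). \<gamma> * K * u i * K ^ card R)"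
      unfolding P_def subset_weight_def by (simp only: sum_product sum.cartesian_product)
    finally show ?thesis by (simp only: power_Suc mult_ac)
  qed
  also have "\<dots> \<le> (\<Sum>(i, R)\<in>S \<times> Pow (- S). ?f (insert i R))"
  proof (intro sum_mono, clarify)
    fix i R assume i: "i \<in> S" and R: "R \<subseteq> - S"
    \<comment> \<open>Entries of \<open>u\<close> on \<open>R\<close> are at least
      \<open>\<gamma>\<close> and the one at \<open>i\<close> is \<open>u i\<close>; as both numbers
      lie in the unit interval, their product is below each of them.\<close>
    have "\<gamma> * u i \<le> Min (u ` insert i R)"
    proof (rule Min_ge)
      fix j assume j: "j \<in> insert i R"
      have "\<gamma> * u i \<le> u i" using u01[of i] g by (simp add: mult_left_le_one_le)
      moreover have "\<gamma> * u i \<le> \<gamma>" using u01[of i] g by (simp add: mult_left_le)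
      ultimately show "\<gamma> * u i \<le> u j" using j u_gamma[of j] R by force
    qed simp
    moreover have "card (insert i R) = Suc (card R)"
      using i R by (subst card_insert_disjoint) auto
    ultimately show "K ^ Suc (card R) * (\<gamma> * u i) \<le> ?f (insert i R)"
      using K by (simp only:) (intro mult_left_mono zero_le_power)
  qed
  also have "\<dots> = sum ?f B2"
    unfolding B2_def by (subst sum.reindex[OF inj]) (simp add: case_prod_unfold)
  finally have 2: "\<gamma> * K * cut_sum A S (- S) * P \<le> sum ?f B2" .
  have "B1 \<inter> B2 = {}" by (auto simp: B1_def B2_def)
  then have "sum ?f B1 + sum ?f B2 = sum ?f (B1 \<union> B2)"
    by (subst sum.union_disjoint) auto
  also have "\<dots> \<le> sum ?f (- {{}})"
    by (rule sum_mono2) (use K u01 in \<open>auto simp: B1_def B2_def intro!: mult_nonneg_nonneg Min_ge\<close>)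
  also have "\<dots> = potential K (A *v cut_vec S)" by (simp add: potential_def u_def)
  finally have "(P - 1) * (1 - b) + \<gamma> * K * cut_sum A S (- S) * P \<le> potential K (A *v cut_vec S)"
    using 1 2 by linarith
  \<comment> \<open>The loss on \<open>B1\<close> is at most \<open>(P - 1) * b\<close>; as
    \<open>b\<close> is nonnegative, it may be enlarged to \<open>P * b\<close>, which gives both
    flows the common factor \<open>P\<close>.\<close>
  then show ?thesis
    unfolding potential_cut_vec using b0
    by (simp add: P_def[symmetric] b_def[symmetric] algebra_simps)
qed

text \<open>Splitting \<open>x\<close> into layers bounds the potential of \<open>A *v x\<close>
  from below by superadditivity, while the potential of \<open>x\<close> itself splits exactly. The
  constant layer is fixed by \<open>A\<close> and cancels, so the drift is estimated layer by
  layer.\<close>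

lemma potential_drift:
  fixes A :: "real ^ 'm::finite ^ 'm"
  assumes A: "stochastic_matrix A" and diag: "\<And>i. \<gamma> \<le> A $ i $ i"
    and g: "0 \<le> \<gamma>" "\<gamma> \<le> 1" and K: "0 \<le> K"
  shows "(\<Sum>S\<in>cuts. gap S x * (subset_weight K (- S) *
      (\<gamma> * K * cut_sum A S (- S) - cut_sum A (- S) S)))
    \<le> potential K (A *v x) - potential K x"
proof -
  define m where "m = Min (range (($) x))"
  define N where "N = (\<Sum>R\<in>(- {{}} :: 'm set set). K ^ card R * m)"
  have "(A *v x) $ i = m + (\<Sum>S\<in>cuts. gap S x * (A *v cut_vec S) $ i)" for i
  proof -
    have "(A *v x) $ i = (\<Sum>j\<in>UNIV. A $ i $ j * x $ j)"
      by (simp add: matrix_vector_mult_def)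
    also have "\<dots> = (\<Sum>j\<in>UNIV. A $ i $ j * m + (\<Sum>S\<in>cuts. gap S x * (A $ i $ j * cut_vec S $ j)))"
    proof (rule sum.cong)
      fix j
      have "x $ j = m + (\<Sum>S\<in>cuts. gap S x * cut_vec S $ j)"
        unfolding m_def by (subst gap_decomposition) (auto intro!: sum.cong simp: cut_vec_def)
      then show "A $ i $ j * x $ j = A $ i $ j * m + (\<Sum>S\<in>cuts. gap S x * (A $ i $ j * cut_vec S $ j))"
        by (simp only: distrib_left sum_distrib_left mult.left_commute)
    qed simp
    also have "\<dots> = (\<Sum>j\<in>UNIV. A $ i $ j) * m + (\<Sum>j\<in>UNIV. \<Sum>S\<in>cuts. gap S x * (A $ i $ j * cut_vec S $ j))"
      by (simp only: sum.distrib sum_distrib_right)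
    also have "\<dots> = m + (\<Sum>j\<in>UNIV. \<Sum>S\<in>cuts. gap S x * (A $ i $ j * cut_vec S $ j))"
      using A by (simp add: stochastic_matrix_def)
    also have "\<dots> = m + (\<Sum>S\<in>cuts. gap S x * (A *v cut_vec S) $ i)"
      by (subst sum.swap) (simp add: matrix_vector_mult_def sum_distrib_left)
    finally show ?thesis .
  qed
  \<comment> \<open>Superadditivity: different layers may attain their minima over \<open>R\<close>
    at different indices.\<close>
  then have "m + (\<Sum>S\<in>cuts. gap S x * Min (($) (A *v cut_vec S) ` R)) \<le> Min (($) (A *v x) ` R)"
    if "R \<noteq> {}" for R
    using that
    by (subst Min_ge_iff) (auto intro!: sum_mono mult_left_mono gap_nonneg Min_le)
  then have "(\<Sum>R\<in>- {{}}. K ^ card R * (m + (\<Sum>S\<in>cuts. gap S x * Min (($) (A *v cut_vec S) ` R))))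
      \<le> potential K (A *v x)"
    unfolding potential_def by (intro sum_mono mult_left_mono) (use K in auto)
  also have "(\<Sum>R\<in>- {{}}. K ^ card R * (m + (\<Sum>S\<in>cuts. gap S x * Min (($) (A *v cut_vec S) ` R))))
      = N + (\<Sum>R\<in>- {{}}. \<Sum>S\<in>cuts. gap S x * (K ^ card R * Min (($) (A *v cut_vec S) ` R)))"
    by (simp only: N_def distrib_left sum.distrib sum_distrib_left mult.left_commute)
  also have "\<dots> = N + (\<Sum>S\<in>cuts. gap S x * potential K (A *v cut_vec S))"
    by (subst sum.swap) (simp add: potential_def sum_distrib_left)
  finally have 1: "N + (\<Sum>S\<in>cuts. gap S x * potential K (A *v cut_vec S)) \<le> potential K (A *v x)" .
  have "potential K x =
      (\<Sum>R\<in>- {{}}. K ^ card R * (m + (\<Sum>S\<in>cuts. gap S x * Min (($) (cut_vec S) ` R))))"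
    unfolding potential_def m_def by (intro sum.cong arg_cong2[of _ _ _ _ "(*)"] Min_gap_decomposition) auto
  also have "\<dots> = N + (\<Sum>R\<in>- {{}}. \<Sum>S\<in>cuts. gap S x * (K ^ card R * Min (($) (cut_vec S) ` R)))"
    by (simp only: N_def distrib_left sum.distrib sum_distrib_left mult.left_commute)
  also have "\<dots> = N + (\<Sum>S\<in>cuts. gap S x * potential K (cut_vec S))"
    by (subst sum.swap) (simp add: potential_def sum_distrib_left)
  finally have 2: "potential K x = N + (\<Sum>S\<in>cuts. gap S x * potential K (cut_vec S))" .
  have "(\<Sum>S\<in>cuts. gap S x * (subset_weight K (- S) *
      (\<gamma> * K * cut_sum A S (- S) - cut_sum A (- S) S)))
    \<le> (\<Sum>S\<in>cuts. gap S x * (potential K (A *v cut_vec S) - potential K (cut_vec S)))"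
    by (intro sum_mono mult_left_mono potential_cut_drift gap_nonneg assms)
  then show ?thesis using 1 2 by (simp add: right_diff_distrib sum_subtractf)
qed

definition disagreement :: "real ^ 'm::finite ^ 'm \<Rightarrow> real ^ 'm \<Rightarrow> real" where
  "disagreement A x = (\<Sum>i\<in>UNIV. \<Sum>j\<in>UNIV. A $ i $ j * \<bar>x $ i - x $ j\<bar>)"

lemma cut_sum_indicator:
  fixes A :: "real ^ 'm::finite ^ 'm"
  shows "cut_sum A S T = (\<Sum>i\<in>UNIV. \<Sum>j\<in>UNIV. if i \<in> S \<and> j \<in> T then A $ i $ j else 0)"
proof -
  have "cut_sum A S T = (\<Sum>i\<in>UNIV. if i \<in> S then \<Sum>j\<in>T. A $ i $ j else 0)"
    unfolding cut_sum_def by (subst sum.inter_restrict[symmetric]) auto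
  also have "\<dots> = (\<Sum>i\<in>UNIV. \<Sum>j\<in>UNIV. if i \<in> S \<and> j \<in> T then A $ i $ j else 0)"
    by (intro sum.cong refl) (auto simp: sum.inter_restrict[symmetric])
  finally show ?thesis .
qed

text \<open>The distance between two entries is covered by the gaps of the cuts separating their
  indices; exchanging sums collects, for each cut, the weights crossing it in either
  direction.\<close>

lemma disagreement_le_cuts:
  fixes A :: "real ^ 'm::finite ^ 'm"
  assumes nn: "\<And>i j. 0 \<le> A $ i $ j"
  shows "disagreement A x \<le> (\<Sum>S\<in>cuts. gap S x * (cut_sum A S (- S) + cut_sum A (- S) S))"
proof -
  let ?sep = "\<lambda>S i j. if (i \<in> S) = (j \<in> S) then 0 else (1::real)"
  have "\<bar>x $ i - x $ j\<bar> \<le> (\<Sum>S\<in>cuts. gap S x * ?sep S i j)" for i j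
  proof -
    have "x $ i - x $ j =
        (\<Sum>S\<in>cuts. (if i \<in> S then 0 else gap S x) - (if j \<in> S then 0 else gap S x))"
      using gap_decomposition[of x i] gap_decomposition[of x j] by (simp add: sum_subtractf)
    also have "\<bar>\<dots>\<bar> \<le> (\<Sum>S\<in>cuts. \<bar>(if i \<in> S then 0 else gap S x) - (if j \<in> S then 0 else gap S x)\<bar>)"
      by (rule sum_abs)
    also have "\<dots> = (\<Sum>S\<in>cuts. gap S x * ?sep S i j)"
      by (intro sum.cong) (auto simp: gap_nonneg)
    finally show ?thesis .
  qed
  then have "disagreement A x \<le> (\<Sum>i\<in>UNIV. \<Sum>j\<in>UNIV. A $ i $ j * (\<Sum>S\<in>cuts. gap S x * ?sep S i j))"
    unfolding disagreement_def by (intro sum_mono mult_left_mono nn)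
  also have "\<dots> = (\<Sum>i\<in>UNIV. \<Sum>j\<in>UNIV. \<Sum>S\<in>cuts. gap S x * (A $ i $ j * ?sep S i j))"
    by (simp only: sum_distrib_left mult.left_commute)
  also have "\<dots> = (\<Sum>S\<in>cuts. \<Sum>i\<in>UNIV. \<Sum>j\<in>UNIV. gap S x * (A $ i $ j * ?sep S i j))"
    by (simp only: sum.swap[of _ cuts])
  also have "\<dots> = (\<Sum>S\<in>cuts. gap S x * (cut_sum A S (- S) + cut_sum A (- S) S))"
    unfolding cut_sum_indicator sum.distrib[symmetric] sum_distrib_left
    by (intro sum.cong refl) auto
  finally show ?thesis .
qed

section \<open>Trajectories and the infinite flow graph\<close>

primrec propagate ::
    "(nat \<Rightarrow> real ^ 'm::finite ^ 'm) \<Rightarrow> nat \<Rightarrow> real ^ 'm \<Rightarrow> nat \<Rightarrow> real ^ 'm" where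
  "propagate A s v 0 = v"
| "propagate A s v (Suc n) = A (Suc (s + n)) *v propagate A s v n"

lemma averaging_trajectory_propagate:
  assumes "averaging_trajectory A s y"
  shows "y (s + n) = propagate A s (y s) n"
  using assms by (induction n) (auto simp: averaging_trajectory_def)

lemma propagate_averaging_trajectory:
  "averaging_trajectory A s (\<lambda>k. propagate A s v (k - s))"
  by (auto simp: averaging_trajectory_def Suc_diff_le)

text \<open>Linearity in the start vector reduces the uncountably many trajectories from time
  \<open>s\<close> to finitely many, one per unit vector.\<close>

lemma propagate_superposition:
  "propagate A s v n = (\<Sum>j\<in>UNIV. v $ j *\<^sub>R propagate A s (axis j 1) n)"
proof (induction n)
  case 0
  show ?case using basis_expansion[of v] by (simp add: scalar_mult_eq_scaleR)
next
  case (Suc n)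
  then show ?case
    by (simp add: linear_sum[OF matrix_vector_mul_linear] linear_scale[OF matrix_vector_mul_linear])
qed

lemma propagate_01:
  assumes A: "\<And>k. stochastic_matrix (A k)" and v: "\<And>i. 0 \<le> v $ i \<and> v $ i \<le> 1"
  shows "0 \<le> propagate A s v n $ i \<and> propagate A s v n $ i \<le> 1"
proof (induction n arbitrary: i)
  case (Suc n)
  have nn: "0 \<le> A k $ i $ j" for k i j using A by (simp add: stochastic_matrix_def)
  have "(\<Sum>j\<in>UNIV. A (Suc (s + n)) $ i $ j * propagate A s v n $ j) \<le>
      (\<Sum>j\<in>UNIV. A (Suc (s + n)) $ i $ j * 1)"
    by (intro sum_mono mult_left_mono nn) (use Suc in auto)
  also have "\<dots> = 1" using A by (simp add: stochastic_matrix_def)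
  finally show ?case
    by (auto simp: matrix_vector_mult_def Suc nn intro!: sum_nonneg mult_nonneg_nonneg)
qed (use v in simp)

text \<open>Since rows sum to 1, the increment of an entry is a row-weighted mean of its differences
  to the other entries, hence bounded by the disagreement. The increments are thus absolutely
  summable and telescope.\<close>

lemma convergent_propagate:
  assumes A: "\<And>k. stochastic_matrix (A k)"
    and D: "summable (\<lambda>n. disagreement (A (Suc (s + n))) (propagate A s v n))"
  shows "convergent (propagate A s v)"
proof -
  have nn: "0 \<le> A k $ i $ j" for k i j using A by (simp add: stochastic_matrix_def)
  have "\<exists>l. (\<lambda>n. propagate A s v n $ i) \<longlonglongrightarrow> l" for i
  proof -
    let ?y = "\<lambda>n. propagate A s v n"
    have "norm (?y (Suc n) $ i - ?y n $ i) \<le> disagreement (A (Suc (s + n))) (?y n)" for n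
    proof -
      let ?B = "A (Suc (s + n))"
      have "?y n $ i = (\<Sum>j\<in>UNIV. ?B $ i $ j) * ?y n $ i"
        using A by (simp add: stochastic_matrix_def)
      then have "?y (Suc n) $ i - ?y n $ i = (\<Sum>j\<in>UNIV. ?B $ i $ j * (?y n $ j - ?y n $ i))"
        by (simp add: matrix_vector_mult_def right_diff_distrib sum_subtractf sum_distrib_right)
      also have "\<bar>\<dots>\<bar> \<le> (\<Sum>j\<in>UNIV. \<bar>?B $ i $ j * (?y n $ j - ?y n $ i)\<bar>)"
        by (rule sum_abs)
      also have "\<dots> = (\<Sum>j\<in>UNIV. ?B $ i $ j * \<bar>?y n $ i - ?y n $ j\<bar>)"
        by (simp add: abs_mult nn abs_minus_commute)
      also have "\<dots> \<le> disagreement ?B (?y n)"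
        unfolding disagreement_def
        by (rule member_le_sum[of i UNIV "\<lambda>i. \<Sum>j\<in>UNIV. ?B $ i $ j * \<bar>?y n $ i - ?y n $ j\<bar>"])
          (auto intro!: sum_nonneg mult_nonneg_nonneg nn)
      finally show ?thesis by simp
    qed
    then have "summable (\<lambda>n. ?y (Suc n) $ i - ?y n $ i)"
      by (intro summable_comparison_test'[OF D, of 0]) auto
    then have "(\<lambda>n. \<Sum>k<n. ?y (Suc k) $ i - ?y k $ i) \<longlonglongrightarrow> (\<Sum>n. ?y (Suc n) $ i - ?y n $ i)"
      by (rule summable_LIMSEQ)
    then have "(\<lambda>n. ?y n $ i - ?y 0 $ i) \<longlonglongrightarrow> (\<Sum>n. ?y (Suc n) $ i - ?y n $ i)"
      by (subst (asm) sum_lessThan_telescope)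
    from tendsto_add[OF this tendsto_const[of "?y 0 $ i"]] show ?thesis by auto
  qed
  then obtain l where l: "\<And>i. (\<lambda>n. propagate A s v n $ i) \<longlonglongrightarrow> l i" by metis
  have "propagate A s v \<longlonglongrightarrow> (\<chi> i. l i)"
    by (rule vec_tendstoI) (use l in simp)
  then show ?thesis by (rule convergentI)
qed

text \<open>If the limits differed, the two entries would eventually stay more than half that
  distance apart, and the flow between \<open>i\<close> and \<open>j\<close> would be dominated by a
  multiple of the summable disagreement.\<close>

lemma limits_agree_if_infinite_flow:
  assumes A: "\<And>k. stochastic_matrix (A k)"
    and D: "summable (\<lambda>n. disagreement (A (Suc (s + n))) (y n))"
    and inf: "\<not> summable (\<lambda>k. A k $ i $ j + A k $ j $ i)"
    and lim: "(\<lambda>n. y n $ i) \<longlonglongrightarrow> a" "(\<lambda>n. y n $ j) \<longlonglongrightarrow> b"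
  shows "a = b"
proof (rule ccontr)
  assume "a \<noteq> b"
  define \<delta> where "\<delta> = \<bar>a - b\<bar> / 2"
  have nn: "0 \<le> A k $ i $ j" for k i j using A by (simp add: stochastic_matrix_def)
  have \<delta>: "0 < \<delta>" "\<delta> < \<bar>a - b\<bar>" using \<open>a \<noteq> b\<close> by (auto simp: \<delta>_def)
  have "(\<lambda>n. \<bar>y n $ i - y n $ j\<bar>) \<longlonglongrightarrow> \<bar>a - b\<bar>" by (intro tendsto_intros lim)
  then have "\<forall>\<^sub>F n in sequentially. \<delta> < \<bar>y n $ i - y n $ j\<bar>" using \<delta>(2) by (rule order_tendstoD)
  then have "\<forall>\<^sub>F n in sequentially. norm (A (n + Suc s) $ i $ j + A (n + Suc s) $ j $ i)
      \<le> 2 / \<delta> * disagreement (A (Suc (s + n))) (y n)"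
  proof eventually_elim
    case (elim n)
    let ?B = "A (Suc (s + n))"
    have term_le: "?B $ p $ q * \<bar>y n $ p - y n $ q\<bar> \<le> disagreement ?B (y n)" for p q
    proof -
      have "?B $ p $ q * \<bar>y n $ p - y n $ q\<bar> \<le> (\<Sum>q\<in>UNIV. ?B $ p $ q * \<bar>y n $ p - y n $ q\<bar>)"
        by (rule member_le_sum[of q UNIV "\<lambda>q. ?B $ p $ q * \<bar>y n $ p - y n $ q\<bar>"])
          (auto intro!: mult_nonneg_nonneg nn)
      also have "\<dots> \<le> disagreement ?B (y n)"
        unfolding disagreement_def
        by (rule member_le_sum[of p UNIV "\<lambda>p. \<Sum>q\<in>UNIV. ?B $ p $ q * \<bar>y n $ p - y n $ q\<bar>"])
          (auto intro!: sum_nonneg mult_nonneg_nonneg nn)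
      finally show ?thesis .
    qed
    have "?B $ i $ j * \<delta> \<le> ?B $ i $ j * \<bar>y n $ i - y n $ j\<bar>"
      "?B $ j $ i * \<delta> \<le> ?B $ j $ i * \<bar>y n $ j - y n $ i\<bar>"
      using elim by (intro mult_left_mono nn; simp add: abs_minus_commute)+
    then have "(?B $ i $ j + ?B $ j $ i) * \<delta> \<le> 2 * disagreement ?B (y n)"
      using term_le[of i j] term_le[of j i] by (simp add: distrib_right)
    then show ?case using \<delta>(1) nn by (simp add: field_simps)
  qed
  then have "summable (\<lambda>n. A (n + Suc s) $ i $ j + A (n + Suc s) $ j $ i)"
    by (rule summable_comparison_test_ev) (intro summable_mult D)
  \<comment> \<open>Discarding the first \<open>Suc s\<close> matrices does not affect
    summability.\<close>
  then show False using inf summable_iff_shift[of "\<lambda>k. A k $ i $ j + A k $ j $ i" "Suc s"] by simp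
qed

text \<open>From a late enough time on, little weight crosses between \<open>S\<close> and its
  complement. A trajectory started then from the indicator of \<open>S\<close> is mixed across the
  cut only by that remainder, so its two sides stay apart.\<close>

lemma limits_differ_if_finite_cut_flow:
  fixes A :: "nat \<Rightarrow> real ^ 'm::finite ^ 'm"
  assumes A: "\<And>k. stochastic_matrix (A k)"
    and conv: "\<And>s y. averaging_trajectory A s y \<Longrightarrow> convergent y"
    and fin: "\<And>p q. p \<in> S \<Longrightarrow> q \<notin> S \<Longrightarrow> summable (\<lambda>k. A k $ p $ q + A k $ q $ p)"
    and ij: "i \<in> S" "j \<notin> S"
  shows "\<exists>s y. averaging_trajectory A s y \<and> lim (\<lambda>k. y k $ i) \<noteq> lim (\<lambda>k. y k $ j)"
proof -
  define c where "c k = (\<Sum>p\<in>S. \<Sum>q\<in>- S. A k $ p $ q + A k $ q $ p)" for k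
  have nn: "0 \<le> A k $ i $ j" for k i j using A by (simp add: stochastic_matrix_def)
  have c_in: "(\<Sum>q\<in>- S. A k $ p $ q) \<le> c k" if "p \<in> S" for k p
  proof -
    have "(\<Sum>q\<in>- S. A k $ p $ q) \<le> (\<Sum>q\<in>- S. A k $ p $ q + A k $ q $ p)"
      by (intro sum_mono) (simp add: nn)
    also have "\<dots> \<le> c k" unfolding c_def
      by (rule member_le_sum[of p S "\<lambda>p. \<Sum>q\<in>- S. A k $ p $ q + A k $ q $ p"])
        (auto intro!: sum_nonneg add_nonneg_nonneg nn that)
    finally show ?thesis .
  qed
  have c_out: "(\<Sum>p\<in>S. A k $ q $ p) \<le> c k" if "q \<notin> S" for k q
  proof (unfold c_def, rule sum_mono)
    fix p
    have "A k $ q $ p \<le> A k $ p $ q + A k $ q $ p" by (simp add: nn)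
    also have "\<dots> \<le> (\<Sum>q\<in>- S. A k $ p $ q + A k $ q $ p)"
      by (rule member_le_sum[of q "- S" "\<lambda>q. A k $ p $ q + A k $ q $ p"])
        (use that in \<open>auto intro!: add_nonneg_nonneg nn\<close>)
    finally show "A k $ q $ p \<le> (\<Sum>q\<in>- S. A k $ p $ q + A k $ q $ p)" .
  qed
  have c0: "0 \<le> c k" for k unfolding c_def by (intro sum_nonneg add_nonneg_nonneg nn)
  have "summable c" unfolding c_def by (intro summable_sum fin) auto
  then obtain N where N: "\<And>n. n \<ge> N \<Longrightarrow> norm (\<Sum>k. c (k + n)) < 1 / 4"
    using suminf_exist_split[of "1 / 4" c] by auto
  \<comment> \<open>The flow across the cut in the first \<open>n\<close> steps after time
    \<open>N\<close>. The bound 1/4 keeps the values on \<open>S\<close> above 3/4 and the others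
    below 1/4.\<close>
  define F where "F n = (\<Sum>l<n. c (Suc (N + l)))" for n
  have F0: "0 \<le> F n" for n unfolding F_def by (intro sum_nonneg c0)
  have F: "F n \<le> 1 / 4" for n
  proof -
    have "F n = (\<Sum>l<n. c (l + Suc N))" by (simp add: F_def add.commute)
    also have "\<dots> \<le> (\<Sum>l. c (l + Suc N))"
      by (intro sum_le_suminf summable_ignore_initial_segment \<open>summable c\<close>) (auto simp: c0)
    finally have "F n \<le> (\<Sum>l. c (l + Suc N))" .
    then show ?thesis using N[of "Suc N"] by simp
  qed
  define v where "v = (cut_vec (- S) :: real ^ 'm)"
  define y where "y = propagate A N v"
  have y01: "0 \<le> y n $ p" "y n $ p \<le> 1" for n p
    unfolding y_def using propagate_01[of A v N n p, OF A] by (auto simp: v_def cut_vec_def)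
  have split: "y (Suc n) $ p =
      (\<Sum>q\<in>S. A (Suc (N + n)) $ p $ q * y n $ q) + (\<Sum>q\<in>- S. A (Suc (N + n)) $ p $ q * y n $ q)" for n p
    unfolding y_def by (subst sum.union_disjoint[symmetric]) (auto simp: matrix_vector_mult_def)
  \<comment> \<open>The accumulated flow bounds the distance from the initial indicator: in each
    step a row draws at most \<open>c (Suc (N + n))\<close> of its weight from the other
    side.\<close>
  have inv: "(\<forall>p\<in>S. 1 - F n \<le> y n $ p) \<and> (\<forall>p\<in>- S. y n $ p \<le> F n)" for n
  proof (induction n)
    case 0
    show ?case by (simp add: F_def y_def v_def cut_vec_def)
  next
    case (Suc n)
    let ?B = "A (Suc (N + n))"
    have FS: "F (Suc n) = F n + c (Suc (N + n))" by (simp add: F_def)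
    have row: "(\<Sum>q\<in>S. ?B $ p $ q) + (\<Sum>q\<in>- S. ?B $ p $ q) = 1" for p
      using A by (subst sum.union_disjoint[symmetric]) (auto simp: stochastic_matrix_def)
    show ?case
    proof (intro conjI ballI)
      fix p assume p: "p \<in> S"
      have "(\<Sum>q\<in>S. ?B $ p $ q) * (1 - F n) \<le> (\<Sum>q\<in>S. ?B $ p $ q * y n $ q)"
        unfolding sum_distrib_right by (intro sum_mono mult_left_mono nn) (use Suc in auto)
      moreover have "0 \<le> (\<Sum>q\<in>- S. ?B $ p $ q * y n $ q)"
        by (intro sum_nonneg mult_nonneg_nonneg nn y01)
      ultimately have "(1 - (\<Sum>q\<in>- S. ?B $ p $ q)) * (1 - F n) \<le> y (Suc n) $ p"
        using row[of p] split[of n p] by (simp add: eq_diff_eq[symmetric])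
      \<comment> \<open>Expanding the product above leaves this nonnegative cross term, which is
        discarded.\<close>
      moreover have "0 \<le> (\<Sum>q\<in>- S. ?B $ p $ q) * F n"
        by (intro mult_nonneg_nonneg sum_nonneg nn F0)
      ultimately show "1 - F (Suc n) \<le> y (Suc n) $ p"
        using c_in[OF p, of "Suc (N + n)"] by (simp add: FS algebra_simps)
    next
      fix p assume p: "p \<in> - S"
      have "(\<Sum>q\<in>S. ?B $ p $ q * y n $ q) \<le> (\<Sum>q\<in>S. ?B $ p $ q * 1)"
        by (intro sum_mono mult_left_mono nn y01)
      moreover have "(\<Sum>q\<in>- S. ?B $ p $ q * y n $ q) \<le> (\<Sum>q\<in>- S. ?B $ p $ q * F n)"
        by (intro sum_mono mult_left_mono nn) (use Suc in auto)
      moreover have "(\<Sum>q\<in>- S. ?B $ p $ q * F n) \<le> 1 * F n"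
        unfolding sum_distrib_right[symmetric]
        by (intro mult_right_mono F0 stochastic_row_le_1 A)
      ultimately show "y (Suc n) $ p \<le> F (Suc n)"
        using c_out[of p "Suc (N + n)"] p split[of n p] by (simp add: FS)
    qed
  qed
  let ?y = "\<lambda>k. y (k - N)"
  have traj: "averaging_trajectory A N ?y"
    unfolding y_def by (rule propagate_averaging_trajectory)
  obtain L where L: "?y \<longlonglongrightarrow> L" using conv[OF traj] by (auto simp: convergent_def)
  have lims: "(\<lambda>k. ?y k $ p) \<longlonglongrightarrow> L $ p" for p by (rule tendsto_vec_nth[OF L])
  have "3 / 4 \<le> ?y k $ i" "?y k $ j \<le> 1 / 4" for k
    using inv[of "k - N"] F[of "k - N"] ij by force+
  then have "3 / 4 \<le> L $ i" "L $ j \<le> 1 / 4"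
    by (intro LIMSEQ_le_const[OF lims] LIMSEQ_le_const2[OF lims]; auto)+
  then have "lim (\<lambda>k. ?y k $ i) \<noteq> lim (\<lambda>k. ?y k $ j)"
    using lims[THEN limI] by simp
  then show ?thesis using traj by blast
qed

lemma same_component_iff_rtrancl:
  "same_component E i j \<longleftrightarrow> (i, j) \<in> {(u, v). {u, v} \<in> E}\<^sup>*"
proof -
  let ?R = "{(u, v). {u, v} \<in> E}"
  have "sym (?R\<^sup>*)" by (intro sym_rtrancl symI) (auto simp: insert_commute)
  then show ?thesis
    unfolding same_component_def connected_components_def quotient_def
    by (auto dest: symD intro: rtrancl_trans)
qed

text \<open>For nonnegative terms an infinite extended sum means failure of summability; the flow is
  symmetric in its endpoints, so either ordering of an edge gives the same series.\<close>

lemma infinite_flow_edges_iff: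
  assumes "\<And>k. stochastic_matrix (W k \<omega>)"
  shows "{u, v} \<in> infinite_flow_edges W \<omega> \<longleftrightarrow>
    \<not> summable (\<lambda>k. W k \<omega> $ u $ v + W k \<omega> $ v $ u)"
proof -
  have nn: "0 \<le> W k \<omega> $ i $ j + W k \<omega> $ j $ i" for k i j
    using assms by (simp add: stochastic_matrix_def)
  have "(\<Sum>k. ennreal (W k \<omega> $ i $ j + W k \<omega> $ j $ i)) = \<infinity> \<longleftrightarrow>
      \<not> summable (\<lambda>k. W k \<omega> $ i $ j + W k \<omega> $ j $ i)" for i j
    using summable_suminf_not_top[of "\<lambda>k. W k \<omega> $ i $ j + W k \<omega> $ j $ i", OF nn]
      ennreal_suminf_neq_top[of "\<lambda>k. W k \<omega> $ i $ j + W k \<omega> $ j $ i", OF _ nn]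
    by auto
  then show ?thesis
    unfolding infinite_flow_edges_def by (auto simp: doubleton_eq_iff add.commute)
qed

text \<open>The pathwise part of the argument, for one fixed sample. Every trajectory converges to a
  combination of the limits for unit vectors, and equality of the latter spreads from edges to paths
  of the flow graph.\<close>

lemma flow_graph_determines_limits:
  fixes W :: "nat \<Rightarrow> 'a \<Rightarrow> real ^ 'm::finite ^ 'm"
  assumes A: "\<And>k. stochastic_matrix (W k \<omega>)"
    and D: "\<And>s j. summable (\<lambda>n. disagreement (W (Suc (s + n)) \<omega>)
      (propagate (\<lambda>k. W k \<omega>) s (axis j 1) n))"
  shows "averaging_trajectory (\<lambda>k. W k \<omega>) s y \<Longrightarrow> convergent y"
    and "same_component (infinite_flow_edges W \<omega>) i j \<longleftrightarrow>
      (\<forall>s y. averaging_trajectory (\<lambda>k. W k \<omega>) s y \<longrightarrow>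
        lim (\<lambda>k. y k $ i) = lim (\<lambda>k. y k $ j))"
proof -
  let ?A = "\<lambda>k. W k \<omega>"
  let ?R = "{(u, v). {u, v} \<in> infinite_flow_edges W \<omega>}"
  have "\<exists>l. propagate ?A s (axis p 1) \<longlonglongrightarrow> l" for s p
    using convergent_propagate[of ?A s "axis p 1", OF A D] by (simp add: convergent_def)
  then obtain l where l: "\<And>s p. propagate ?A s (axis p 1) \<longlonglongrightarrow> l s p" by metis
  have edge: "l s p $ u = l s p $ v" if "(u, v) \<in> ?R" for s p u v
    using that infinite_flow_edges_iff[of W \<omega> u v, OF A]
    by (intro limits_agree_if_infinite_flow[of ?A, OF A D _ tendsto_vec_nth[OF l] tendsto_vec_nth[OF l]]) auto
  have comp: "l s p $ u = l s p $ v" if "(u, v) \<in> ?R\<^sup>*" for s p u v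
    using that by induction (auto simp: edge)
  have y_lim: "y \<longlonglongrightarrow> (\<Sum>p\<in>UNIV. y s $ p *\<^sub>R l s p)" if "averaging_trajectory ?A s y" for s y
  proof -
    have "(\<lambda>n. \<Sum>p\<in>UNIV. y s $ p *\<^sub>R propagate ?A s (axis p 1) n) \<longlonglongrightarrow> (\<Sum>p\<in>UNIV. y s $ p *\<^sub>R l s p)"
      by (intro tendsto_intros l)
    then have "(\<lambda>n. y (n + s)) \<longlonglongrightarrow> (\<Sum>p\<in>UNIV. y s $ p *\<^sub>R l s p)"
      using averaging_trajectory_propagate[OF that] propagate_superposition[of ?A s "y s"]
      by (simp add: add.commute)
    then show ?thesis by (rule LIMSEQ_offset)
  qed
  then show conv: "convergent y" if "averaging_trajectory ?A s y" for s y
    using that convergentI by blast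
  show "same_component (infinite_flow_edges W \<omega>) i j \<longleftrightarrow>
      (\<forall>s y. averaging_trajectory ?A s y \<longrightarrow> lim (\<lambda>k. y k $ i) = lim (\<lambda>k. y k $ j))"
    unfolding same_component_iff_rtrancl
  proof (intro iffI allI impI)
    fix s y assume ij: "(i, j) \<in> ?R\<^sup>*" and y: "averaging_trajectory ?A s y"
    have "lim (\<lambda>k. y k $ q) = (\<Sum>p\<in>UNIV. y s $ p *\<^sub>R l s p) $ q" for q
      by (intro limI tendsto_vec_nth y_lim y)
    then show "lim (\<lambda>k. y k $ i) = lim (\<lambda>k. y k $ j)"
      using comp[OF ij] by simp
  next
    assume *: "\<forall>s y. averaging_trajectory ?A s y \<longrightarrow> lim (\<lambda>k. y k $ i) = lim (\<lambda>k. y k $ j)"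
    show "(i, j) \<in> ?R\<^sup>*"
    proof (rule ccontr)
      assume "(i, j) \<notin> ?R\<^sup>*"
      \<comment> \<open>The cut is the component of \<open>i\<close>; an edge of infinite flow
        leaving it would enlarge it.\<close>
      moreover have "summable (\<lambda>k. ?A k $ p $ q + ?A k $ q $ p)"
        if "p \<in> ?R\<^sup>* `` {i}" "q \<notin> ?R\<^sup>* `` {i}" for p q
        using that infinite_flow_edges_iff[of W \<omega> p q, OF A] by (auto intro: rtrancl_into_rtrancl)
      ultimately have "\<exists>s y. averaging_trajectory ?A s y \<and> lim (\<lambda>k. y k $ i) \<noteq> lim (\<lambda>k. y k $ j)"
        by (intro limits_differ_if_finite_cut_flow[of ?A "?R\<^sup>* `` {i}"] A) (auto dest: conv)
      then show False using * by blast
    qed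
  qed
qed

section \<open>Expected growth of the potential\<close>

lemma gap_le_1:
  assumes "\<And>i. 0 \<le> x $ i \<and> x $ i \<le> 1" "S \<in> cuts"
  shows "gap S x \<le> 1"
proof -
  obtain a b where "a \<in> S" "b \<notin> S" using assms(2) by (auto simp: cuts_def)
  then have "Min (($) x ` (- S)) \<le> x $ b" "x $ a \<le> Max (($) x ` S)" by auto
  then show ?thesis using assms(1)[of a] assms(1)[of b] by (auto simp: gap_def)
qed

lemma cut_sum_bounds:
  fixes A :: "real ^ 'm::finite ^ 'm"
  assumes "stochastic_matrix A"
  shows "0 \<le> cut_sum A S T" "cut_sum A S T \<le> real CARD('m)"
proof -
  show "0 \<le> cut_sum A S T"
    using assms by (auto simp: cut_sum_def stochastic_matrix_def intro!: sum_nonneg)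
  have "cut_sum A S T \<le> (\<Sum>i\<in>S. 1)"
    unfolding cut_sum_def by (intro sum_mono stochastic_row_le_1 assms)
  also have "\<dots> \<le> real CARD('m)" by (simp add: card_mono)
  finally show "cut_sum A S T \<le> real CARD('m)" .
qed

lemma disagreement_nonneg:
  assumes "stochastic_matrix A"
  shows "0 \<le> disagreement A x"
  using assms
  by (auto simp: disagreement_def stochastic_matrix_def intro!: sum_nonneg mult_nonneg_nonneg)

section \<open>Measurability and histories\<close>

lemma borel_measurable_component:
  fixes f :: "'a \<Rightarrow> 'b::second_countable_topology ^ 'm::finite"
  assumes "f \<in> borel_measurable M"
  shows "(\<lambda>\<omega>. f \<omega> $ i) \<in> borel_measurable M"
  by (rule borel_measurable_continuous_on[OF _ assms]) (intro continuous_intros)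

lemma borel_measurable_gap:
  assumes "f \<in> borel_measurable M"
  shows "(\<lambda>\<omega>. gap S (f \<omega>)) \<in> borel_measurable M"
  unfolding gap_def
  by (intro borel_measurable_max borel_measurable_diff borel_measurable_const
      borel_measurable_Min[where f = "\<lambda>i \<omega>. f \<omega> $ i"]
      borel_measurable_Max[where f = "\<lambda>i \<omega>. f \<omega> $ i"] borel_measurable_component assms) auto

lemma borel_measurable_potential:
  assumes "f \<in> borel_measurable M"
  shows "(\<lambda>\<omega>. potential K (f \<omega>)) \<in> borel_measurable M"
  unfolding potential_def
  by (intro borel_measurable_sum borel_measurable_times borel_measurable_const
      borel_measurable_Min[where f = "\<lambda>i \<omega>. f \<omega> $ i"] borel_measurable_component assms) auto

lemma borel_measurable_cut_sum:
  assumes "f \<in> borel_measurable M"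
  shows "(\<lambda>\<omega>. cut_sum (f \<omega>) S T) \<in> borel_measurable M"
  unfolding cut_sum_def by (intro borel_measurable_sum borel_measurable_component assms)

lemma borel_measurable_disagreement:
  assumes "f \<in> borel_measurable M" "g \<in> borel_measurable M"
  shows "(\<lambda>\<omega>. disagreement (f \<omega>) (g \<omega>)) \<in> borel_measurable M"
  unfolding disagreement_def
  by (intro borel_measurable_sum borel_measurable_times borel_measurable_abs borel_measurable_diff
      borel_measurable_component assms)

lemma borel_measurable_matrix_vector_mult:
  fixes f :: "'a \<Rightarrow> real ^ 'n::finite ^ 'm::finite"
  assumes "f \<in> borel_measurable M" "g \<in> borel_measurable M"
  shows "(\<lambda>\<omega>. f \<omega> *v g \<omega>) \<in> borel_measurable M"
  by (rule borel_measurable_continuous_Pair[OF assms])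
    (unfold matrix_vector_mult_def, intro continuous_intros)

lemma space_history [simp]: "space (history M x0 W k) = space M"
  unfolding history_def by (intro space_measure_of) auto

lemma sets_history:
  "sets (history M x0 W k) = sigma_sets (space M)
     ({x0 -` A \<inter> space M | A. A \<in> sets borel} \<union>
      {W j -` A \<inter> space M | j A. 1 \<le> j \<and> j \<le> k \<and> A \<in> sets borel})"
  unfolding history_def by (intro sets_measure_of) auto

lemma subalgebra_history:
  assumes "x0 \<in> borel_measurable M" "\<And>k. W k \<in> borel_measurable M"
  shows "subalgebra M (history M x0 W k)"
  unfolding subalgebra_def sets_history
  by (auto intro!: sets.sigma_sets_subset measurable_sets[OF assms(1)] measurable_sets[OF assms(2)])

lemma borel_measurable_history:
  assumes "1 \<le> j" "j \<le> k"
  shows "W j \<in> borel_measurable (history M x0 W k)"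
  by (rule measurableI) (use assms in \<open>auto simp: sets_history intro!: sigma_sets.Basic\<close>)

text \<open>The state at time \<open>s + n\<close> involves only matrices with indices up to
  \<open>s + n\<close>. Its gaps are therefore known when conditioning the next matrix, and can be
  moved through the conditional expectation.\<close>

lemma borel_measurable_propagate:
  assumes "s + n \<le> k"
  shows "(\<lambda>\<omega>. propagate (\<lambda>j. W j \<omega>) s v n) \<in> borel_measurable (history M x0 W k)"
  using assms
proof (induction n)
  case (Suc n)
  then show ?case
    by (auto intro!: borel_measurable_matrix_vector_mult borel_measurable_history)
qed simp

text \<open>Under an integral with an \<open>F\<close>-measurable weight a function may be replaced
  by its conditional expectation, and a nonnegative weight preserves the inequality.\<close>

lemma (in sigma_finite_subalgebra) real_cond_exp_weighted_mono:
  assumes AE: "AE \<omega> in M. \<alpha> * real_cond_exp M F b \<omega> \<le> real_cond_exp M F a \<omega>"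
    and d: "d \<in> borel_measurable F" "\<And>\<omega>. 0 \<le> d \<omega>"
    and meas: "a \<in> borel_measurable M" "b \<in> borel_measurable M"
    and int: "integrable M (\<lambda>\<omega>. d \<omega> * a \<omega>)" "integrable M (\<lambda>\<omega>. d \<omega> * b \<omega>)"
  shows "\<alpha> * (\<integral>\<omega>. d \<omega> * b \<omega> \<partial>M) \<le> (\<integral>\<omega>. d \<omega> * a \<omega> \<partial>M)"
proof -
  note a = real_cond_exp_intg[OF int(1) d(1) meas(1)]
  note b = real_cond_exp_intg[OF int(2) d(1) meas(2)]
  have "\<alpha> * (\<integral>\<omega>. d \<omega> * b \<omega> \<partial>M) = (\<integral>\<omega>. \<alpha> * (d \<omega> * real_cond_exp M F b \<omega>) \<partial>M)"
    by (simp add: b(2))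
  also have "\<dots> \<le> (\<integral>\<omega>. d \<omega> * real_cond_exp M F a \<omega> \<partial>M)"
  proof (rule integral_mono_AE)
    show "AE \<omega> in M. \<alpha> * (d \<omega> * real_cond_exp M F b \<omega>) \<le> d \<omega> * real_cond_exp M F a \<omega>"
      using AE by eventually_elim (metis d(2) mult.left_commute mult_left_mono)
  qed (use a b in auto)
  also have "\<dots> = (\<integral>\<omega>. d \<omega> * a \<omega> \<partial>M)" by (rule a(2))
  finally show ?thesis .
qed

text \<open>The pathwise lower bound on the drift may be negative; balancedness makes it dominate
  the disagreement after integration. Integrability holds because the states stay in the unit
  cube.\<close>

lemma expected_disagreement_step:
  fixes W :: "nat \<Rightarrow> 'a \<Rightarrow> real ^ 'm::finite ^ 'm" and s :: nat
  assumes M: "prob_space M"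
    and W: "\<And>k. W k \<in> borel_measurable M" "\<And>k \<omega>. \<omega> \<in> space M \<Longrightarrow> stochastic_matrix (W k \<omega>)"
    and x0: "x0 \<in> borel_measurable M"
    and \<alpha>: "0 < \<alpha>" "\<And>S k. S \<in> cuts \<Longrightarrow> AE \<omega> in M.
      \<alpha> * real_cond_exp M (history M x0 W k) (\<lambda>\<omega>. cut_sum (W (Suc k) \<omega>) S (- S)) \<omega>
        \<le> real_cond_exp M (history M x0 W k) (\<lambda>\<omega>. cut_sum (W (Suc k) \<omega>) (- S) S) \<omega>"
    and \<gamma>: "0 < \<gamma>" "\<gamma> \<le> 1" "\<And>i k. AE \<omega> in M. \<gamma> \<le> W k \<omega> $ i $ i"
    and v: "\<And>i. 0 \<le> v $ i \<and> v $ i \<le> 1"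
  defines "K \<equiv> (1 + 2 / \<alpha>) / \<gamma>"
  defines "Y \<equiv> \<lambda>n \<omega>. propagate (\<lambda>k. W k \<omega>) s v n"
  shows "integrable M (\<lambda>\<omega>. potential K (Y n \<omega>))"
    and "integrable M (\<lambda>\<omega>. disagreement (W (Suc (s + n)) \<omega>) (Y n \<omega>))"
    and "(\<integral>\<omega>. disagreement (W (Suc (s + n)) \<omega>) (Y n \<omega>) \<partial>M)
      \<le> (\<integral>\<omega>. potential K (Y (Suc n) \<omega>) \<partial>M) - (\<integral>\<omega>. potential K (Y n \<omega>) \<partial>M)"
proof -
  interpret prob_space M by (rule M)
  let ?F = "history M x0 W (s + n)"
  have sub: "subalgebra M (history M x0 W k)" for k by (rule subalgebra_history[OF x0 W(1)])
  interpret finite_measure_subalgebra M ?F by unfold_locales (rule sub)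
  have K0: "0 \<le> K" using \<alpha>(1) \<gamma>(1) by (simp add: K_def)
  have Y01: "0 \<le> Y n \<omega> $ i \<and> Y n \<omega> $ i \<le> 1" if "\<omega> \<in> space M" for n \<omega> i
    unfolding Y_def by (rule propagate_01[OF W(2)[OF that] v])
  have YF: "Y n \<in> borel_measurable ?F" unfolding Y_def by (rule borel_measurable_propagate) simp
  have Y: "Y n \<in> borel_measurable M" for n
    unfolding Y_def by (rule measurable_from_subalg[OF sub borel_measurable_propagate[OF order_refl]])
  have int_V: "integrable M (\<lambda>\<omega>. potential K (Y n \<omega>))" for n
  proof (rule integrable_const_bound[where B = "subset_weight K (UNIV :: 'm set)"])
    show "AE \<omega> in M. norm (potential K (Y n \<omega>)) \<le> subset_weight K (UNIV :: 'm set)"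
    proof (rule AE_I2)
      fix \<omega> assume "\<omega> \<in> space M"
      then show "norm (potential K (Y n \<omega>)) \<le> subset_weight K (UNIV :: 'm set)"
        using potential_bounds[OF K0 Y01, of \<omega> n] by simp
    qed
  qed (rule borel_measurable_potential[OF Y])
  then show "integrable M (\<lambda>\<omega>. potential K (Y n \<omega>))" .
  let ?A = "W (Suc (s + n))"
  let ?g = "\<lambda>S \<omega>. gap S (Y n \<omega>)"
  let ?a = "\<lambda>S \<omega>. cut_sum (?A \<omega>) S (- S)"
  let ?b = "\<lambda>S \<omega>. cut_sum (?A \<omega>) (- S) S"
  have int_cut: "integrable M (\<lambda>\<omega>. ?g S \<omega> * cut_sum (?A \<omega>) T U)" if "S \<in> cuts" for S T U
  proof (rule integrable_const_bound[where B = "1 * real CARD('m)"])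
    show "AE \<omega> in M. norm (?g S \<omega> * cut_sum (?A \<omega>) T U) \<le> 1 * real CARD('m)"
    proof (rule AE_I2)
      fix \<omega> assume \<omega>: "\<omega> \<in> space M"
      have "?g S \<omega> * cut_sum (?A \<omega>) T U \<le> 1 * real CARD('m)"
        by (intro mult_mono gap_le_1 cut_sum_bounds Y01 W \<omega> that) auto
      then show "norm (?g S \<omega> * cut_sum (?A \<omega>) T U) \<le> 1 * real CARD('m)"
        using cut_sum_bounds(1)[OF W(2)[OF \<omega>]] by (simp add: gap_nonneg)
    qed
  qed (intro borel_measurable_times borel_measurable_gap borel_measurable_cut_sum Y W)
  have int_ab: "integrable M (\<lambda>\<omega>. \<Sum>S\<in>cuts. ?g S \<omega> * (?a S \<omega> + ?b S \<omega>))"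
    unfolding distrib_left by (intro Bochner_Integration.integrable_sum Bochner_Integration.integrable_add int_cut)
  have D_le: "disagreement (?A \<omega>) (Y n \<omega>) \<le> (\<Sum>S\<in>cuts. ?g S \<omega> * (?a S \<omega> + ?b S \<omega>))"
    if "\<omega> \<in> space M" for \<omega>
    by (rule disagreement_le_cuts) (use W(2)[OF that] in \<open>simp add: stochastic_matrix_def\<close>)
  have int_D: "integrable M (\<lambda>\<omega>. disagreement (?A \<omega>) (Y n \<omega>))"
  proof (rule Bochner_Integration.integrable_bound[OF int_ab])
    show "AE \<omega> in M. norm (disagreement (?A \<omega>) (Y n \<omega>)) \<le> norm (\<Sum>S\<in>cuts. ?g S \<omega> * (?a S \<omega> + ?b S \<omega>))"
    proof (rule AE_I2)
      fix \<omega> assume "\<omega> \<in> space M"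
      then show "norm (disagreement (?A \<omega>) (Y n \<omega>)) \<le> norm (\<Sum>S\<in>cuts. ?g S \<omega> * (?a S \<omega> + ?b S \<omega>))"
        using D_le[of \<omega>] disagreement_nonneg[OF W(2), of \<omega> "Suc (s + n)" "Y n \<omega>"] by simp
    qed
  qed (rule borel_measurable_disagreement[OF W(1) Y])
  then show "integrable M (\<lambda>\<omega>. disagreement (?A \<omega>) (Y n \<omega>))" .
  let ?E = "\<lambda>f. \<integral>\<omega>. f \<omega> \<partial>M"
  let ?Ea = "\<lambda>S. \<integral>\<omega>. ?g S \<omega> * ?a S \<omega> \<partial>M"
  let ?Eb = "\<lambda>S. \<integral>\<omega>. ?g S \<omega> * ?b S \<omega> \<partial>M"
  have bal: "\<alpha> * ?Eb S \<le> ?Ea S" if "S \<in> cuts" for S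
  proof (rule real_cond_exp_weighted_mono)
    \<comment> \<open>Passing to the complement turns the assumption into a bound on the weights
      \<open>?b\<close>, which lower the potential, by the weights \<open>?a\<close>, which raise
      it.\<close>
    have "- S \<in> cuts" using that by (auto simp: cuts_def)
    from \<alpha>(2)[OF this, of "s + n"]
    show "AE \<omega> in M. \<alpha> * real_cond_exp M ?F (?b S) \<omega> \<le> real_cond_exp M ?F (?a S) \<omega>" by simp
  qed (intro borel_measurable_gap YF gap_nonneg borel_measurable_cut_sum W int_cut that)+
  have Eb0: "0 \<le> ?Eb S" for S
    by (rule integral_nonneg_AE, rule AE_I2) (auto intro!: mult_nonneg_nonneg gap_nonneg cut_sum_bounds W)
  have cut_le: "?Ea S + ?Eb S \<le> subset_weight K (- S) * (\<gamma> * K * ?Ea S - ?Eb S)" if "S \<in> cuts" for S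
  proof -
    \<comment> \<open>Of the excess \<open>2 / \<alpha>\<close>, one half pays for the subtracted
      \<open>?Eb S\<close>, the other for its share in the total flow.\<close>
    have "\<gamma> * K = 1 + 2 / \<alpha>" using \<gamma>(1) by (simp add: K_def)
    moreover have "?Eb S \<le> ?Ea S / \<alpha>" using bal[OF that] \<alpha>(1) by (simp add: field_simps)
    ultimately have *: "?Ea S + ?Eb S \<le> \<gamma> * K * ?Ea S - ?Eb S" by (simp add: distrib_right)
    \<comment> \<open>The bracket is nonnegative, so a factor of at least 1 only enlarges
      it.\<close>
    have "0 \<le> ?Ea S" using bal[OF that] Eb0[of S] \<alpha>(1) by (smt (verit) mult_nonneg_nonneg)
    then have "1 * (\<gamma> * K * ?Ea S - ?Eb S) \<le> subset_weight K (- S) * (\<gamma> * K * ?Ea S - ?Eb S)"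
      using * Eb0[of S] by (intro mult_right_mono subset_weight_ge_1 K0) linarith
    then show ?thesis using * by simp
  qed
  have int_drift: "integrable M (\<lambda>\<omega>. ?g S \<omega> * (subset_weight K (- S) * (\<gamma> * K * ?a S \<omega> - ?b S \<omega>)))"
    "(\<integral>\<omega>. ?g S \<omega> * (subset_weight K (- S) * (\<gamma> * K * ?a S \<omega> - ?b S \<omega>)) \<partial>M)
      = subset_weight K (- S) * (\<gamma> * K * ?Ea S - ?Eb S)" if "S \<in> cuts" for S
  proof -
    have eq: "(\<lambda>\<omega>. ?g S \<omega> * (subset_weight K (- S) * (\<gamma> * K * ?a S \<omega> - ?b S \<omega>))) =
        (\<lambda>\<omega>. subset_weight K (- S) * (\<gamma> * K * (?g S \<omega> * ?a S \<omega>) - ?g S \<omega> * ?b S \<omega>))"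
      by (simp add: fun_eq_iff algebra_simps)
    note ints = int_cut[OF that, of S "- S"] int_cut[OF that, of "- S" S]
    show "integrable M (\<lambda>\<omega>. ?g S \<omega> * (subset_weight K (- S) * (\<gamma> * K * ?a S \<omega> - ?b S \<omega>)))"
      unfolding eq using ints by auto
    show "(\<integral>\<omega>. ?g S \<omega> * (subset_weight K (- S) * (\<gamma> * K * ?a S \<omega> - ?b S \<omega>)) \<partial>M)
        = subset_weight K (- S) * (\<gamma> * K * ?Ea S - ?Eb S)"
      unfolding eq using ints by simp
  qed
  have "?E (\<lambda>\<omega>. disagreement (?A \<omega>) (Y n \<omega>)) \<le> ?E (\<lambda>\<omega>. \<Sum>S\<in>cuts. ?g S \<omega> * (?a S \<omega> + ?b S \<omega>))"
    by (intro integral_mono int_D int_ab D_le)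
  also have "\<dots> = (\<Sum>S\<in>cuts. ?Ea S + ?Eb S)"
    by (simp add: distrib_left int_cut)
  also have "\<dots> \<le> (\<Sum>S\<in>cuts. subset_weight K (- S) * (\<gamma> * K * ?Ea S - ?Eb S))"
    by (intro sum_mono cut_le)
  also have "\<dots> = ?E (\<lambda>\<omega>. \<Sum>S\<in>cuts. ?g S \<omega> * (subset_weight K (- S) * (\<gamma> * K * ?a S \<omega> - ?b S \<omega>)))"
    by (subst Bochner_Integration.integral_sum, rule int_drift(1), assumption)
      (intro sum.cong refl int_drift(2)[symmetric])
  also have "\<dots> \<le> ?E (\<lambda>\<omega>. potential K (Y (Suc n) \<omega>) - potential K (Y n \<omega>))"
  proof (rule integral_mono_AE)
    \<comment> \<open>The diagonal bound has one null set per index; finitely many are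
      united.\<close>
    have "AE \<omega> in M. \<forall>i. \<gamma> \<le> ?A \<omega> $ i $ i" by (simp add: AE_all_countable \<gamma>(3))
    then show "AE \<omega> in M. (\<Sum>S\<in>cuts. ?g S \<omega> * (subset_weight K (- S) * (\<gamma> * K * ?a S \<omega> - ?b S \<omega>)))
        \<le> potential K (Y (Suc n) \<omega>) - potential K (Y n \<omega>)"
    proof (rule AE_mp, intro AE_I2 impI)
      fix \<omega> assume "\<omega> \<in> space M" "\<forall>i. \<gamma> \<le> ?A \<omega> $ i $ i"
      then show "(\<Sum>S\<in>cuts. ?g S \<omega> * (subset_weight K (- S) * (\<gamma> * K * ?a S \<omega> - ?b S \<omega>)))
          \<le> potential K (Y (Suc n) \<omega>) - potential K (Y n \<omega>)"
        using potential_drift[OF W(2) _ less_imp_le[OF \<gamma>(1)] \<gamma>(2) K0, of \<omega> "Suc (s + n)" "Y n \<omega>"]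
        by (simp add: Y_def)
    qed
  qed (auto intro!: Bochner_Integration.integrable_sum int_drift int_V)
  also have "\<dots> = ?E (\<lambda>\<omega>. potential K (Y (Suc n) \<omega>)) - ?E (\<lambda>\<omega>. potential K (Y n \<omega>))"
    by (rule Bochner_Integration.integral_diff[OF int_V int_V])
  finally show "?E (\<lambda>\<omega>. disagreement (?A \<omega>) (Y n \<omega>))
      \<le> ?E (\<lambda>\<omega>. potential K (Y (Suc n) \<omega>)) - ?E (\<lambda>\<omega>. potential K (Y n \<omega>))" .
qed

text \<open>Expected disagreements are dominated by increments of a bounded expected potential, so
  telescoping bounds their partial sums. A nonnegative random series with finite expected sum
  converges almost surely.\<close>

lemma AE_summable_disagreement:
  fixes W :: "nat \<Rightarrow> 'a \<Rightarrow> real ^ 'm::finite ^ 'm" and s :: nat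
  assumes M: "prob_space M"
    and W: "\<And>k. W k \<in> borel_measurable M" "\<And>k \<omega>. \<omega> \<in> space M \<Longrightarrow> stochastic_matrix (W k \<omega>)"
    and x0: "x0 \<in> borel_measurable M"
    and \<alpha>: "0 < \<alpha>" "\<And>S k. S \<in> cuts \<Longrightarrow> AE \<omega> in M.
      \<alpha> * real_cond_exp M (history M x0 W k) (\<lambda>\<omega>. cut_sum (W (Suc k) \<omega>) S (- S)) \<omega>
        \<le> real_cond_exp M (history M x0 W k) (\<lambda>\<omega>. cut_sum (W (Suc k) \<omega>) (- S) S) \<omega>"
    and \<gamma>: "0 < \<gamma>" "\<gamma> \<le> 1" "\<And>i k. AE \<omega> in M. \<gamma> \<le> W k \<omega> $ i $ i"
    and v: "\<And>i. 0 \<le> v $ i \<and> v $ i \<le> 1"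
  shows "AE \<omega> in M. summable (\<lambda>n. disagreement (W (Suc (s + n)) \<omega>) (propagate (\<lambda>k. W k \<omega>) s v n))"
proof -
  interpret prob_space M by (rule M)
  define K where "K = (1 + 2 / \<alpha>) / \<gamma>"
  let ?Y = "\<lambda>n \<omega>. propagate (\<lambda>k. W k \<omega>) s v n"
  let ?D = "\<lambda>n \<omega>. disagreement (W (Suc (s + n)) \<omega>) (?Y n \<omega>)"
  let ?C = "subset_weight K (UNIV :: 'm set)"
  note step = expected_disagreement_step[OF assms, folded K_def]
  have K0: "0 \<le> K" using \<alpha>(1) \<gamma>(1) by (simp add: K_def)
  have V: "0 \<le> potential K (?Y n \<omega>)" "potential K (?Y n \<omega>) \<le> ?C" if "\<omega> \<in> space M" for n \<omega>
    by (intro potential_bounds K0 propagate_01[OF W(2)[OF that] v])+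
  have D0: "0 \<le> ?D n \<omega>" if "\<omega> \<in> space M" for n \<omega>
    by (rule disagreement_nonneg[OF W(2)[OF that]])
  have ED0: "0 \<le> (\<integral>\<omega>. ?D n \<omega> \<partial>M)" for n
    by (intro integral_nonneg_AE AE_I2 D0)
  have part: "(\<Sum>n<N. \<integral>\<omega>. ?D n \<omega> \<partial>M) \<le> ?C" for N
  proof -
    have "(\<Sum>n<N. \<integral>\<omega>. ?D n \<omega> \<partial>M) \<le>
        (\<Sum>n<N. (\<integral>\<omega>. potential K (?Y (Suc n) \<omega>) \<partial>M) - (\<integral>\<omega>. potential K (?Y n \<omega>) \<partial>M))"
      by (intro sum_mono step(3))
    also have "\<dots> = (\<integral>\<omega>. potential K (?Y N \<omega>) \<partial>M) - (\<integral>\<omega>. potential K (?Y 0 \<omega>) \<partial>M)"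
      by (rule sum_lessThan_telescope)
    also have "(\<integral>\<omega>. potential K (?Y N \<omega>) \<partial>M) \<le> (\<integral>\<omega>. ?C \<partial>M)"
      by (intro integral_mono step(1) V) auto
    also have "(\<integral>\<omega>. ?C \<partial>M) - (\<integral>\<omega>. potential K (?Y 0 \<omega>) \<partial>M) \<le> ?C"
    proof -
      have "0 \<le> (\<integral>\<omega>. potential K (?Y 0 \<omega>) \<partial>M)" by (intro integral_nonneg_AE AE_I2 V)
      then show ?thesis by (simp add: prob_space)
    qed
    finally show ?thesis by simp
  qed
  have D_meas: "(\<lambda>\<omega>. ennreal (?D n \<omega>)) \<in> borel_measurable M" for n
    using borel_measurable_integrable[OF step(2)] by measurable
  have "(\<integral>\<^sup>+\<omega>. (\<Sum>n. ennreal (?D n \<omega>)) \<partial>M) = (\<Sum>n. \<integral>\<^sup>+\<omega>. ennreal (?D n \<omega>) \<partial>M)"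
    by (rule nn_integral_suminf[OF D_meas])
  also have "\<dots> = (\<Sum>n. ennreal (\<integral>\<omega>. ?D n \<omega> \<partial>M))"
    by (intro suminf_cong nn_integral_eq_integral step(2) AE_I2 D0)
  also have "\<dots> \<noteq> \<infinity>"
    using ennreal_suminf_neq_top[OF summableI_nonneg_bounded[OF ED0 part] ED0] by simp
  finally have "AE \<omega> in M. (\<Sum>n. ennreal (?D n \<omega>)) \<noteq> \<infinity>"
    by (intro nn_integral_PInf_AE borel_measurable_suminf_order D_meas)
  then show ?thesis
    by (rule AE_mp, intro AE_I2 impI summable_suminf_not_top) (use D0 in auto)
qed

text \<open>One null set serves all trajectories: it is a union over the countably many pairs of a
  start time and a unit vector, and off it the pathwise result covers every start.\<close>

theorem theorem1:
  fixes M :: "'a measure"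
    and W :: "nat \<Rightarrow> 'a \<Rightarrow> real ^ 'm ^ 'm"
    and x :: "nat \<Rightarrow> 'a \<Rightarrow> real ^ 'm"
    and \<gamma> :: real
  assumes "prob_space M"
    and "random_stochastic_matrix_process M W"
    and "x 0 \<in> borel_measurable M"
    and "adapted M (x 0) W"
    and "balanced M (x 0) W"
    and "\<gamma> > 0"
    and "\<And>i k. AE \<omega> in M. W k \<omega> $ i $ i \<ge> \<gamma>"
    and "\<And>\<omega>. \<omega> \<in> space M \<Longrightarrow> averaging_trajectory (\<lambda>k. W k \<omega>) 0 (\<lambda>k. x k \<omega>)"
  shows "AE \<omega> in M.
      convergent (\<lambda>k. x k \<omega>) \<and>
      (\<forall>i j. same_component (infinite_flow_edges W \<omega>) i j \<longrightarrow>
         lim (\<lambda>k. x k \<omega> $ i) = lim (\<lambda>k. x k \<omega> $ j)) \<and>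
      (\<forall>s y. averaging_trajectory (\<lambda>k. W k \<omega>) s y \<longrightarrow> convergent y) \<and>
      (\<forall>i j. same_component (infinite_flow_edges W \<omega>) i j \<longleftrightarrow>
         (\<forall>s y. averaging_trajectory (\<lambda>k. W k \<omega>) s y \<longrightarrow>
            lim (\<lambda>k. y k $ i) = lim (\<lambda>k. y k $ j)))"
proof -
  have W: "\<And>k. W k \<in> borel_measurable M" "\<And>k \<omega>. \<omega> \<in> space M \<Longrightarrow> stochastic_matrix (W k \<omega>)"
    using assms(2) by (auto simp: random_stochastic_matrix_process_def)
  obtain \<alpha> where \<alpha>: "0 < \<alpha>" "\<And>S k. S \<in> cuts \<Longrightarrow> AE \<omega> in M.
      \<alpha> * real_cond_exp M (history M (x 0) W k) (\<lambda>\<omega>. cut_sum (W (Suc k) \<omega>) S (- S)) \<omega>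
        \<le> real_cond_exp M (history M (x 0) W k) (\<lambda>\<omega>. cut_sum (W (Suc k) \<omega>) (- S) S) \<omega>"
    using assms(5) by (auto simp: balanced_def cuts_def)
  \<comment> \<open>Replacing \<open>\<gamma>\<close> by \<open>min \<gamma> 1\<close> meets the
    condition \<open>\<gamma> \<le> 1\<close> of the drift estimate and keeps the bound
    positive.\<close>
  have diag: "AE \<omega> in M. min \<gamma> 1 \<le> W k \<omega> $ i $ i" for i k
    using assms(7)[of k i] by eventually_elim auto
  have "AE \<omega> in M. summable (\<lambda>n. disagreement (W (Suc (s + n)) \<omega>)
      (propagate (\<lambda>k. W k \<omega>) s (axis j 1) n))" for s and j :: 'm
    by (rule AE_summable_disagreement[OF assms(1) W assms(3) \<alpha> _ _ diag])
      (use assms(6) in \<open>auto simp: axis_def\<close>)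
  then have "AE \<omega> in M. \<forall>s. \<forall>j::'m. summable (\<lambda>n. disagreement (W (Suc (s + n)) \<omega>)
      (propagate (\<lambda>k. W k \<omega>) s (axis j 1) n))"
    by (simp add: AE_all_countable)
  then show ?thesis
  proof (rule AE_mp, intro AE_I2 impI)
    fix \<omega> assume \<omega>: "\<omega> \<in> space M" and "\<forall>s. \<forall>j::'m. summable (\<lambda>n. disagreement (W (Suc (s + n)) \<omega>)
      (propagate (\<lambda>k. W k \<omega>) s (axis j 1) n))"
    then have D: "\<And>s j. summable (\<lambda>n. disagreement (W (Suc (s + n)) \<omega>)
      (propagate (\<lambda>k. W k \<omega>) s (axis j 1) n))" by blast
    note * = flow_graph_determines_limits[of W \<omega>, OF W(2)[OF \<omega>] D]
    note x = assms(8)[OF \<omega>]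
    show "convergent (\<lambda>k. x k \<omega>) \<and>
      (\<forall>i j. same_component (infinite_flow_edges W \<omega>) i j \<longrightarrow>
         lim (\<lambda>k. x k \<omega> $ i) = lim (\<lambda>k. x k \<omega> $ j)) \<and>
      (\<forall>s y. averaging_trajectory (\<lambda>k. W k \<omega>) s y \<longrightarrow> convergent y) \<and>
      (\<forall>i j. same_component (infinite_flow_edges W \<omega>) i j \<longleftrightarrow>
         (\<forall>s y. averaging_trajectory (\<lambda>k. W k \<omega>) s y \<longrightarrow>
            lim (\<lambda>k. y k $ i) = lim (\<lambda>k. y k $ j)))"
    proof (intro conjI allI impI)
      fix i j assume "same_component (infinite_flow_edges W \<omega>) i j"
      then show "lim (\<lambda>k. x k \<omega> $ i) = lim (\<lambda>k. x k \<omega> $ j)"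
        unfolding *(2) using x by blast
    qed (use x *(1) in blast, use *(1) in blast, rule *(2))
  qed
qed

end
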